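(* Let $0\le\varepsilon<1$ and suppose $\zeta^{\mathbf{\Theta}}_r(\mu)>0$. If $\mathbf{\Theta}$ is a $U\to\ell_2$ $\varepsilon$-subspace embedding for $U_r$, and the columns of $\mathbf{U}_r$ are orthonormal with respect to $\langle\cdot,\cdot\rangle^{\mathbf{\Theta}}_U$, then the condition number (ratio of the maximal to the minimal singular value, i.e. $\max_{\mathbf{a}\ne\mathbf{0}}\frac{\|\mathbf{V}^{\mathbf{\Theta}}_r(\mu)\mathbf{a}\|}{\|\mathbf{a}\|}\big/\min_{\mathbf{a}\neq\mathbf{0}}\frac{\|\mathbf{V}^{\mathbf{\Theta}}_r(\mu)\mathbf{a}\|}{\|\mathbf{a}\|}$ over $\mathbf{a}\in\mathbb{K}^r$) of the matrix $\mathbf{V}^{\mathbf{\Theta}}_r(\mu):=\mathbf{\Theta}\mathbf{R}_U^{-1}\mathbf{A}(\mu)\mathbf{U}_r$ is bounded by $$\sqrt{\frac{1+\varepsilon}{1-\varepsilon}}\;\frac{\iota^{\mathbf{\Theta}}_r(\mu)}{\zeta^{\mathbf{\Theta}}_r(\mu)}.$$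
   Context: Let $\mathbb{K}=\mathbb{R}$ or $\mathbb{C}$, $U=U'=\mathbb{K}^n$, $\langle\cdot,\cdot\rangle$ and $\|\cdot\|$ the canonical $\ell_2$-inner product and norm. $\mathbf{R}_U\in\mathbb{K}^{n\times n}$ is symmetric (Hermitian if $\mathbb{K}=\mathbb{C}$) positive definite, and $U$ is equipped with $\langle\cdot,\cdot\rangle_U=\langle\mathbf{R}_U\cdot,\cdot\rangle$, with norm $\|\cdot\|_U$. For $\mathbf{\Theta}\in\mathbb{K}^{k\times n}$ ($k\le n$), define the semi-inner product $\langle\mathbf{x},\mathbf{y}\rangle^{\mathbf{\Theta}}_U=\langle\mathbf{\Theta}\mathbf{x},\mathbf{\Theta}\mathbf{y}\rangle$ on $U$ and the semi-norm $\|\mathbf{y}\|^{\mathbf{\Theta}}_{U'}=\|\mathbf{\Theta}\mathbf{R}_U^{-1}\mathbf{y}\|$ on $U'$. $\mathbf{\Theta}$ is a $U\to\ell_2$ $\varepsilon$-subspace embedding for a subspace $V\subset U$ if $|\langle\mathbf{x},\mathbf{y}\rangle_U-\langle\mathbf{x},\mathbf{y}\rangle^{\mathbf{\Theta}}_U|\le\varepsilon\|\mathbf{x}\|_U\|\mathbf{y}\|_U$ for all $\mathbf{x},\mathbf{y}\in V$. For a fixed parameter value $\mu$, $\mathbf{A}(\mu)\in\mathbb{K}^{n\times n}$ (a linear operator $U\to U'$), $\mathbf{b}(\mu)\in U'$, and $\mathbf{u}(\mu)\in U$ satisfies $\mathbf{A}(\mu)\mathbf{u}(\mu)=\mathbf{b}(\mu)$.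 $U_r\subset U$ is a subspace of dimension $r\ge1$ and $\mathbf{U}_r\in\mathbb{K}^{n\times r}$ is a matrix whose columns form a basis of $U_r$. Define $$\zeta^{\mathbf{\Theta}}_r(\mu)=\min_{\mathbf{x}\in(\mathrm{span}\{\mathbf{u}(\mu)\}+U_r)\setminus\{\mathbf{0}\}}\frac{\|\mathbf{A}(\mu)\mathbf{x}\|^{\mathbf{\Theta}}_{U'}}{\|\mathbf{x}\|_U},\qquad \iota^{\mathbf{\Theta}}_r(\mu)=\max_{\mathbf{x}\in(\mathrm{span}\{\mathbf{u}(\mu)\}+U_r)\setminus\{\mathbf{0}\}}\frac{\|\mathbf{A}(\mu)\mathbf{x}\|^{\mathbf{\Theta}}_{U'}}{\|\mathbf{x}\|_U}.$$ *)

theory Defs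
  imports "HOL-Analysis.Analysis" "Jordan_Normal_Form.Conjugate"
begin

text \<open>
  The scalar field \<open>\<real>\<close> or \<open>\<complex>\<close>.  By Gelfand--Mazur every instance is isometrically
  isomorphic to one of the two, and the last axiom forces the conjugation to be the identity
  or the complex conjugation, respectively.
\<close>

class rc_field = real_normed_field + conjugatable_field + euclidean_space +
  assumes mult_conjugate: "x * conjugate x = (norm x)\<^sup>2 *\<^sub>R 1"

instance real :: rc_field
  by standard (simp add: power2_eq_square)

instance complex :: rc_field
  by standard (metis complex_norm_square conjugate_complex_def of_real_def)

lemma mult_conjugate_eq: "x * conjugate x = of_real ((norm x)\<^sup>2)" for x :: "'a::rc_field"
  unfolding of_real_def by (rule mult_conjugate)

text \<open>
  The inner product is linear in the first argument.  (The library's \<open>inner\<close> on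
  \<open>complex ^ 'n\<close> is only its real part.)
\<close>

definition cinner :: "'a::rc_field ^ 'n \<Rightarrow> 'a ^ 'n \<Rightarrow> 'a" where
  "cinner x y = (\<Sum>i\<in>UNIV. x $ i * conjugate (y $ i))"

definition hermitian :: "'a::rc_field ^ 'n ^ 'n \<Rightarrow> bool" where
  "hermitian R \<longleftrightarrow> (\<forall>i j. R $ i $ j = conjugate (R $ j $ i))"

text \<open>Positivity of a scalar means that it is real and positive.\<close>

definition positive_definite :: "'a::rc_field ^ 'n ^ 'n \<Rightarrow> bool" where
  "positive_definite R \<longleftrightarrow>
     (\<forall>x. x \<noteq> 0 \<longrightarrow> (\<exists>c::real. c > 0 \<and> cinner (R *v x) x = of_real c))"

definition inner_U :: "'a::rc_field ^ 'n ^ 'n \<Rightarrow> 'a ^ 'n \<Rightarrow> 'a ^ 'n \<Rightarrow> 'a" where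
  "inner_U R x y = cinner (R *v x) y"

text \<open>
  For positive definite \<open>R\<close> the scalar \<open>inner_U R x x\<close> is a nonnegative real, so its modulus is
  just its value as a real number.
\<close>

definition norm_U :: "'a::rc_field ^ 'n ^ 'n \<Rightarrow> 'a ^ 'n \<Rightarrow> real" where
  "norm_U R x = sqrt (norm (inner_U R x x))"

definition sketched_inner :: "'a::rc_field ^ 'n ^ 'k \<Rightarrow> 'a ^ 'n \<Rightarrow> 'a ^ 'n \<Rightarrow> 'a" where
  "sketched_inner \<Theta> x y = cinner (\<Theta> *v x) (\<Theta> *v y)"

definition sketched_dual_norm ::
  "'a::rc_field ^ 'n ^ 'k \<Rightarrow> 'a ^ 'n ^ 'n \<Rightarrow> 'a ^ 'n \<Rightarrow> real" where
  "sketched_dual_norm \<Theta> R y = norm (\<Theta> *v (matrix_inv R *v y))"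

definition subspace_embedding ::
  "'a::rc_field ^ 'n ^ 'k \<Rightarrow> 'a ^ 'n ^ 'n \<Rightarrow> real \<Rightarrow> ('a ^ 'n) set \<Rightarrow> bool" where
  "subspace_embedding \<Theta> R \<epsilon> V \<longleftrightarrow>
     (\<forall>x\<in>V. \<forall>y\<in>V. norm (inner_U R x y - sketched_inner \<Theta> x y) \<le> \<epsilon> * norm_U R x * norm_U R y)"

definition columns_basis :: "'a::rc_field ^ 'r ^ 'n \<Rightarrow> ('a ^ 'n) set \<Rightarrow> bool" where
  "columns_basis B V \<longleftrightarrow>
     inj (\<lambda>i. column i B) \<and> vec.independent (columns B) \<and> vec.span (columns B) = V"

definition sketched_orthonormal_columns ::
  "'a::rc_field ^ 'n ^ 'k \<Rightarrow> 'a ^ 'r ^ 'n \<Rightarrow> bool" where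
  "sketched_orthonormal_columns \<Theta> B \<longleftrightarrow>
     (\<forall>i j. sketched_inner \<Theta> (column i B) (column j B) = (if i = j then 1 else 0))"

definition span_plus :: "'a::rc_field ^ 'n \<Rightarrow> ('a ^ 'n) set \<Rightarrow> ('a ^ 'n) set" where
  "span_plus u V = {s + v | s v. s \<in> vec.span {u} \<and> v \<in> V}"

text \<open>
  Minima and maxima are written as infima and suprema of sets of real numbers; the lemmas
  \<open>zeta_attained\<close>, \<open>iota_attained\<close>, \<open>max_gain_attained\<close> and \<open>min_gain_attained\<close> below show that
  they are attained.
\<close>

definition zeta ::
  "'a::rc_field ^ 'n ^ 'k \<Rightarrow> 'a ^ 'n ^ 'n \<Rightarrow> 'a ^ 'n ^ 'n \<Rightarrow> 'a ^ 'n \<Rightarrow> ('a ^ 'n) set \<Rightarrow> real" where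
  "zeta \<Theta> R A u V =
     (INF x \<in> span_plus u V - {0}. sketched_dual_norm \<Theta> R (A *v x) / norm_U R x)"

definition iota ::
  "'a::rc_field ^ 'n ^ 'k \<Rightarrow> 'a ^ 'n ^ 'n \<Rightarrow> 'a ^ 'n ^ 'n \<Rightarrow> 'a ^ 'n \<Rightarrow> ('a ^ 'n) set \<Rightarrow> real" where
  "iota \<Theta> R A u V =
     (SUP x \<in> span_plus u V - {0}. sketched_dual_norm \<Theta> R (A *v x) / norm_U R x)"

definition max_gain :: "'a::rc_field ^ 'r ^ 'k \<Rightarrow> real" where
  "max_gain M = (SUP a \<in> UNIV - {0}. norm (M *v a) / norm a)"

definition min_gain :: "'a::rc_field ^ 'r ^ 'k \<Rightarrow> real" where
  "min_gain M = (INF a \<in> UNIV - {0}. norm (M *v a) / norm a)"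

definition condition_number :: "'a::rc_field ^ 'r ^ 'k \<Rightarrow> real" where
  "condition_number M = max_gain M / min_gain M"

lemma scaleR_eq_vec_scale: "c *\<^sub>R x = (of_real c :: 'a::rc_field) *s (x :: 'a ^ 'n)"
  by (simp add: vec_eq_iff scaleR_conv_of_real[where 'a = 'a])

lemma vec_subspace_imp_subspace:
  fixes S :: "('a::rc_field ^ 'n) set"
  assumes "vec.subspace S"
  shows "subspace S"
  using assms unfolding subspace_def vec.subspace_def by (simp add: scaleR_eq_vec_scale)

lemma conjugate_of_real: "conjugate (of_real c :: 'a::rc_field) = of_real c"
proof (cases "c = 0")
  case False
  have "of_real c * conjugate (of_real c :: 'a) = of_real c * of_real c"
    by (simp add: mult_conjugate_eq power2_eq_square flip: of_real_mult)
  with False show ?thesis by simp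
qed simp

lemma norm_conjugate: "norm (conjugate (x :: 'a::rc_field)) = norm x"
proof (cases "x = 0")
  case False
  have "norm x * norm (conjugate x) = norm x * norm x"
    by (metis mult_conjugate_eq norm_mult norm_of_real abs_of_nonneg zero_le_power2 power2_eq_square)
  with False show ?thesis by simp
qed simp

lemma continuous_on_conjugate [continuous_intros]:
  fixes f :: "'b::topological_space \<Rightarrow> 'a::rc_field"
  assumes "continuous_on S f"
  shows "continuous_on S (\<lambda>x. conjugate (f x))"
proof -
  have *: "conjugate (x - y) = conjugate x - conjugate (y :: 'a)" for x y
    by (metis conjugate_dist_add conjugate_neg diff_conv_add_uminus)
  have "continuous_on UNIV (conjugate :: 'a \<Rightarrow> 'a)"
    unfolding continuous_on_iff dist_norm by (metis * norm_conjugate)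
  then show ?thesis
    using assms continuous_on_compose2 by blast
qed

lemma continuous_on_matrix_vector_mult:
  fixes M :: "'a::rc_field ^ 'n ^ 'm"
  shows "continuous_on S (\<lambda>x. M *v x)"
  unfolding matrix_vector_mult_def by (intro continuous_intros)

lemma continuous_on_norm_U:
  fixes R :: "'a::rc_field ^ 'n ^ 'n"
  shows "continuous_on S (norm_U R)"
  unfolding norm_U_def inner_U_def cinner_def
  by (intro continuous_intros continuous_on_matrix_vector_mult)

lemma norm_U_pos:
  assumes "positive_definite R" "x \<noteq> 0"
  shows "norm_U R x > 0"
  using assms unfolding norm_U_def inner_U_def positive_definite_def by fastforce

lemma norm_vec_scale: "norm (c *s (x :: 'a::rc_field ^ 'n)) = norm c * norm x"
  by (simp add: norm_vec_def norm_mult L2_set_right_distrib)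

lemma norm_U_scaleR: "norm_U R (c *\<^sub>R x) = \<bar>c\<bar> * norm_U R x"
proof -
  have "inner_U R (c *\<^sub>R x) (c *\<^sub>R x) = of_real (c * c) * inner_U R x x"
    by (simp add: inner_U_def cinner_def scaleR_eq_vec_scale conjugate_dist_mul conjugate_of_real
        vec.scale sum_distrib_left mult_ac)
  then show ?thesis
    by (simp add: norm_U_def norm_mult real_sqrt_mult)
qed

lemma norm_matrix_scaleR: "norm (M *v (c *\<^sub>R x)) = \<bar>c\<bar> * norm (M *v (x :: 'a::rc_field ^ 'n))"
  by (simp add: scaleR_eq_vec_scale vec.scale norm_vec_scale)

lemma cinner_self: "cinner x x = of_real ((norm x)\<^sup>2)"
  by (simp add: cinner_def mult_conjugate_eq norm_vec_def L2_set_def sum_nonneg)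

lemma norm_U_mat_1: "norm_U (mat 1) x = norm x"
  by (simp add: norm_U_def inner_U_def cinner_self norm_power)

lemma quotient_attained:
  fixes S :: "('a::rc_field ^ 'n) set" and p q :: "'a ^ 'n \<Rightarrow> real"
  assumes S: "vec.subspace S" "S \<noteq> {0}"
    and cont: "continuous_on UNIV p" "continuous_on UNIV q"
    and hom: "\<And>c x. p (c *\<^sub>R x) = \<bar>c\<bar> * p x" "\<And>c x. q (c *\<^sub>R x) = \<bar>c\<bar> * q x"
    and pos: "\<And>x. x \<noteq> 0 \<Longrightarrow> q x > 0"
  shows "\<exists>x\<in>S - {0}. (INF y \<in> S - {0}. p y / q y) = p x / q x \<and> (\<forall>y\<in>S - {0}. p x / q x \<le> p y / q y)"
    and "\<exists>x\<in>S - {0}. (SUP y \<in> S - {0}. p y / q y) = p x / q x \<and> (\<forall>y\<in>S - {0}. p y / q y \<le> p x / q x)"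
proof -
  have sub: "subspace S" using S(1) by (rule vec_subspace_imp_subspace)
  let ?K = "S \<inter> sphere 0 1"
  let ?f = "\<lambda>x. p x / q x"
  have K: "compact ?K" by (simp add: sub closed_subspace closed_Int_compact)
  have norm: "inverse (norm y) *\<^sub>R y \<in> ?K" "?f (inverse (norm y) *\<^sub>R y) = ?f y"
    if "y \<in> S - {0}" for y
    using that sub by (auto simp: hom subspace_scale)
  have K_ne: "?K \<noteq> {}"
    using norm(1) S subspace_0[OF sub] by blast
  have K_sub: "?K \<subseteq> S - {0}" by auto
  have "continuous_on ?K ?f"
    using K_sub pos by (intro continuous_intros cont[THEN continuous_on_subset]) fastforce+
  from continuous_attains_inf[OF K K_ne this] continuous_attains_sup[OF K K_ne this]
  obtain l m where l: "l \<in> ?K" "\<forall>y\<in>?K. ?f l \<le> ?f y" and m: "m \<in> ?K" "\<forall>y\<in>?K. ?f y \<le> ?f m"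
    by blast
  have l': "\<forall>y\<in>S - {0}. ?f l \<le> ?f y" and m': "\<forall>y\<in>S - {0}. ?f y \<le> ?f m"
    using l(2) m(2) norm by metis+
  have "(INF y \<in> S - {0}. ?f y) = ?f l"
    using l(1) K_sub l' by (intro cInf_eq_minimum) auto
  then show "\<exists>x\<in>S - {0}. (INF y \<in> S - {0}. ?f y) = ?f x \<and> (\<forall>y\<in>S - {0}. ?f x \<le> ?f y)"
    using l(1) K_sub l' by (intro bexI[of _ l]) auto
  have "(SUP y \<in> S - {0}. ?f y) = ?f m"
    using m(1) K_sub m' by (intro cSup_eq_maximum) auto
  then show "\<exists>x\<in>S - {0}. (SUP y \<in> S - {0}. ?f y) = ?f x \<and> (\<forall>y\<in>S - {0}. ?f y \<le> ?f x)"
    using m(1) K_sub m' by (intro bexI[of _ m]) auto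
qed

lemma span_plus_subspace: "vec.subspace V \<Longrightarrow> vec.subspace (span_plus u V)"
  unfolding span_plus_def by (rule vec.subspace_sums[OF vec.subspace_span])

lemma subset_span_plus: "V \<subseteq> span_plus u V"
  unfolding span_plus_def using vec.span_zero by force

lemma
  assumes "positive_definite R" "vec.subspace V" "V \<noteq> {0}"
  shows zeta_attained:
      "\<exists>x\<in>span_plus u V - {0}. zeta \<Theta> R A u V = sketched_dual_norm \<Theta> R (A *v x) / norm_U R x \<and>
        (\<forall>y\<in>span_plus u V - {0}. zeta \<Theta> R A u V \<le> sketched_dual_norm \<Theta> R (A *v y) / norm_U R y)"
    and iota_attained:
      "\<exists>x\<in>span_plus u V - {0}. iota \<Theta> R A u V = sketched_dual_norm \<Theta> R (A *v x) / norm_U R x \<and>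
        (\<forall>y\<in>span_plus u V - {0}. sketched_dual_norm \<Theta> R (A *v y) / norm_U R y \<le> iota \<Theta> R A u V)"
proof -
  let ?S = "span_plus u V" and ?p = "\<lambda>x. sketched_dual_norm \<Theta> R (A *v x)"
  have p: "?p = (\<lambda>x. norm ((\<Theta> ** matrix_inv R ** A) *v x))"
    by (simp add: fun_eq_iff sketched_dual_norm_def matrix_vector_mul_assoc matrix_mul_assoc)
  have S: "vec.subspace ?S" "?S \<noteq> {0}"
    using assms(2,3) span_plus_subspace subset_span_plus[of V u] vec.subspace_0[OF assms(2)] by blast+
  have c: "continuous_on UNIV ?p"
    unfolding p by (intro continuous_intros continuous_on_matrix_vector_mult)
  have h: "?p (c *\<^sub>R x) = \<bar>c\<bar> * ?p x" for c x
    using norm_matrix_scaleR p by metis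
  note q = quotient_attained[OF S c continuous_on_norm_U h norm_U_scaleR norm_U_pos[OF assms(1)]]
  show "\<exists>x\<in>?S - {0}. zeta \<Theta> R A u V = ?p x / norm_U R x \<and>
        (\<forall>y\<in>?S - {0}. zeta \<Theta> R A u V \<le> ?p y / norm_U R y)"
    unfolding zeta_def using q(1) by force
  show "\<exists>x\<in>?S - {0}. iota \<Theta> R A u V = ?p x / norm_U R x \<and>
        (\<forall>y\<in>?S - {0}. ?p y / norm_U R y \<le> iota \<Theta> R A u V)"
    unfolding iota_def using q(2) by force
qed

lemma
  fixes M :: "'a::rc_field ^ 'r ^ 'k"
  shows min_gain_attained:
      "\<exists>a\<in>UNIV - {0}. min_gain M = norm (M *v a) / norm a \<and>
        (\<forall>b\<in>UNIV - {0}. min_gain M \<le> norm (M *v b) / norm b)"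
    and max_gain_attained:
      "\<exists>a\<in>UNIV - {0}. max_gain M = norm (M *v a) / norm a \<and>
        (\<forall>b\<in>UNIV - {0}. norm (M *v b) / norm b \<le> max_gain M)"
proof -
  have "(1 :: 'a ^ 'r) \<noteq> 0" by simp
  then have S: "vec.subspace (UNIV :: ('a ^ 'r) set)" "(UNIV :: ('a ^ 'r) set) \<noteq> {0}" by auto
  have "continuous_on UNIV (\<lambda>a. norm (M *v a))"
    by (intro continuous_intros continuous_on_matrix_vector_mult)
  note q = quotient_attained[OF S this continuous_on_norm_id norm_matrix_scaleR norm_scaleR]
  show "\<exists>a\<in>UNIV - {0}. min_gain M = norm (M *v a) / norm a \<and>
        (\<forall>b\<in>UNIV - {0}. min_gain M \<le> norm (M *v b) / norm b)"
    unfolding min_gain_def using q(1) by force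
  show "\<exists>a\<in>UNIV - {0}. max_gain M = norm (M *v a) / norm a \<and>
        (\<forall>b\<in>UNIV - {0}. norm (M *v b) / norm b \<le> max_gain M)"
    unfolding max_gain_def using q(2) by force
qed

end

theory Submission
  imports Defs
begin

text \<open>
  Sketched orthonormality makes \<open>a \<mapsto> B a\<close> an isometry from \<open>\<ell>\<^sub>2\<close> onto \<open>V\<close> with the sketched
  norm, and the embedding property with both arguments equal to \<open>x = B a\<close> then gives
  \<open>(1 - \<epsilon>) \<parallel>x\<parallel>\<^sub>U\<^sup>2 \<le> \<parallel>a\<parallel>\<^sup>2 \<le> (1 + \<epsilon>) \<parallel>x\<parallel>\<^sub>U\<^sup>2\<close>.  Since the reduced matrix maps \<open>a\<close> to a vector of
  norm between \<open>\<zeta> \<parallel>x\<parallel>\<^sub>U\<close> and \<open>\<iota> \<parallel>x\<parallel>\<^sub>U\<close>, its gains lie between \<open>\<zeta> / sqrt (1 + \<epsilon>)\<close> and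
  \<open>\<iota> / sqrt (1 - \<epsilon>)\<close>.
\<close>

lemma cinner_sum_left: "cinner (sum f S) y = (\<Sum>i\<in>S. cinner (f i) y)"
  unfolding cinner_def by (subst sum.swap) (simp add: sum_distrib_right)

lemma cinner_sum_right: "cinner x (sum f S) = (\<Sum>i\<in>S. cinner x (f i))"
proof (cases "finite S")
  case True
  then show ?thesis
    unfolding cinner_def by (subst sum.swap) (simp add: sum_conjugate sum_distrib_left)
qed (simp add: cinner_def)

lemma cinner_scale_left: "cinner (c *s x) y = c * cinner x y"
  by (simp add: cinner_def sum_distrib_left mult.assoc)

lemma cinner_scale_right: "cinner x (c *s y) = conjugate c * cinner x y"
  by (simp add: cinner_def sum_distrib_left conjugate_dist_mul mult_ac)

text \<open>Sesquilinearity expands both arguments over the columns of \<open>B\<close>, and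
  orthonormality leaves only the diagonal of the double sum.\<close>

lemma sketched_inner_orthonormal:
  assumes "sketched_orthonormal_columns \<Theta> B"
  shows "sketched_inner \<Theta> (B *v a) (B *v a) = of_real ((norm a)\<^sup>2)"
proof -
  have "\<Theta> *v (B *v a) = (\<Sum>i\<in>UNIV. a $ i *s (\<Theta> *v column i B))"
    by (simp add: matrix_mult_sum[of B] vec.sum vec.scale)
  then have "sketched_inner \<Theta> (B *v a) (B *v a) =
      (\<Sum>i\<in>UNIV. \<Sum>j\<in>UNIV. a $ i * (conjugate (a $ j) * sketched_inner \<Theta> (column i B) (column j B)))"
    unfolding sketched_inner_def
    by (simp only: cinner_sum_left cinner_scale_left)
      (simp add: cinner_sum_right cinner_scale_right sum_distrib_left)
  also have "\<dots> = (\<Sum>i\<in>UNIV. \<Sum>j\<in>UNIV. if i = j then a $ i * conjugate (a $ i) else 0)"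
    using assms by (intro sum.cong) (auto simp: sketched_orthonormal_columns_def)
  also have "\<dots> = cinner a a"
    by (simp add: cinner_def)
  finally show ?thesis
    by (simp add: cinner_self)
qed

text \<open>\<open>norm_U\<close> takes a modulus first; positive definiteness makes the scalar
  itself real and positive, so nothing is lost. It is silent about the zero vector, hence the case
  split.\<close>

lemma inner_U_self:
  assumes "positive_definite R"
  shows "inner_U R x x = of_real ((norm_U R x)\<^sup>2)"
proof (cases "x = 0")
  case False
  then obtain c where "c > 0" "inner_U R x x = of_real c"
    using assms unfolding positive_definite_def inner_U_def by blast
  then show ?thesis
    by (simp add: norm_U_def)
qed (simp add: norm_U_def inner_U_def cinner_def)

lemma norm_U_nonneg [simp]: "0 \<le> norm_U R x"
  by (simp add: norm_U_def)

lemma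
  assumes "positive_definite R" "subspace_embedding \<Theta> R \<epsilon> V" "0 \<le> \<epsilon>" "\<epsilon> < 1"
    and "sketched_orthonormal_columns \<Theta> B" "B *v a \<in> V"
  shows embedding_coordinates_upper: "norm a \<le> sqrt (1 + \<epsilon>) * norm_U R (B *v a)"
    and embedding_coordinates_lower: "sqrt (1 - \<epsilon>) * norm_U R (B *v a) \<le> norm a"
proof -
  let ?q = "norm_U R (B *v a)"
  have "norm (of_real (?q\<^sup>2) - of_real ((norm a)\<^sup>2) :: 'a) \<le> \<epsilon> * ?q * ?q"
    using assms(2,6) inner_U_self[OF assms(1)] sketched_inner_orthonormal[OF assms(5)]
    unfolding subspace_embedding_def by metis
  \<comment> \<open>Both inner products are embedded reals, so the modulus in the field becomes an
    absolute value in the reals.\<close>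
  then have "\<bar>?q\<^sup>2 - (norm a)\<^sup>2\<bar> \<le> \<epsilon> * ?q\<^sup>2"
    by (simp only: norm_of_real power2_eq_square mult.assoc flip: of_real_diff)
  then have *: "(norm a)\<^sup>2 \<le> (1 + \<epsilon>) * ?q\<^sup>2" "(1 - \<epsilon>) * ?q\<^sup>2 \<le> (norm a)\<^sup>2"
    by (simp_all add: abs_le_iff algebra_simps)
  show "norm a \<le> sqrt (1 + \<epsilon>) * ?q" "sqrt (1 - \<epsilon>) * ?q \<le> norm a"
    by (rule power2_le_imp_le; use assms(3,4) * in \<open>simp add: power_mult_distrib\<close>)+
qed

theorem proposition3p5:
  fixes \<Theta> :: "'a::rc_field ^ 'n ^ 'k"
    and R A :: "'a ^ 'n ^ 'n"
    and b u :: "'a ^ 'n"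
    and V :: "('a ^ 'n) set"
    and B :: "'a ^ 'r ^ 'n"
    and \<epsilon> :: real
  assumes "CARD('k) \<le> CARD('n)"
    and "hermitian R" and "positive_definite R"
    and "A *v u = b"
    and "vec.subspace V" and "vec.dim V = CARD('r)" and "columns_basis B V"
    and "0 \<le> \<epsilon>" and "\<epsilon> < 1"
    and "zeta \<Theta> R A u V > 0"
    and "subspace_embedding \<Theta> R \<epsilon> V"
    and "sketched_orthonormal_columns \<Theta> B"
  shows "condition_number (\<Theta> ** matrix_inv R ** A ** B)
           \<le> sqrt ((1 + \<epsilon>) / (1 - \<epsilon>)) * (iota \<Theta> R A u V / zeta \<Theta> R A u V)"
proof -
  let ?M = "\<Theta> ** matrix_inv R ** A ** B" and ?z = "zeta \<Theta> R A u V" and ?i = "iota \<Theta> R A u V"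
  let ?p = "\<lambda>x. sketched_dual_norm \<Theta> R (A *v x)"
  have V: "B *v a \<in> V" for a
    using assms(7) matrix_vector_mult_in_columnspace_gen unfolding columns_basis_def by blast
  note up = embedding_coordinates_upper[OF assms(3,11,8,9,12) V]
    and low = embedding_coordinates_lower[OF assms(3,11,8,9,12) V]
  have M: "norm (?M *v a) = ?p (B *v a)" for a
    by (simp add: sketched_dual_norm_def matrix_vector_mul_assoc matrix_mul_assoc)
  \<comment> \<open>Injectivity is read off the upper bound: \<open>B *v a = 0\<close> would force
    \<open>norm a \<le> 0\<close>.\<close>
  have nz: "B *v a \<noteq> 0" if "a \<noteq> 0" for a
    using up[of a] that by (auto simp: norm_U_def inner_U_def cinner_def)
  \<comment> \<open>The all-ones vector witnesses a nonzero element of \<open>V\<close>, which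
    attainment of \<open>zeta\<close> and \<open>iota\<close> requires.\<close>
  have "(1 :: 'a ^ 'r) \<noteq> 0"
    by simp
  then have "V \<noteq> {0}"
    using V nz by blast
  note att = zeta_attained[OF assms(3,5) this, of u \<Theta> A] iota_attained[OF assms(3,5) this, of u \<Theta> A]
  have S: "B *v a \<in> span_plus u V - {0}" if "a \<noteq> 0" for a
    using V nz[OF that] subset_span_plus by blast
  have "?z \<le> ?p x / norm_U R x" "?p x / norm_U R x \<le> ?i" if "x \<in> span_plus u V - {0}" for x
    using att that by blast+
  then have z: "?z * norm_U R (B *v a) \<le> norm (?M *v a)"
    and i: "norm (?M *v a) \<le> ?i * norm_U R (B *v a)" if "a \<noteq> 0" for a
    unfolding M using S[OF that] norm_U_pos[OF assms(3) nz[OF that]]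
    by (metis pos_le_divide_eq, metis pos_divide_le_eq)
  have i0: "0 \<le> ?i"
    using att(2) by (auto simp: sketched_dual_norm_def)
  obtain a where a: "a \<noteq> 0" "max_gain ?M = norm (?M *v a) / norm a"
    using max_gain_attained[of ?M] by blast
  \<comment> \<open>The factor \<open>sqrt (1 - \<epsilon>)\<close> lets \<open>low\<close> replace
    the U-norm by \<open>norm a\<close>; since \<open>\<epsilon> < 1\<close>, it can be divided out
    afterwards.\<close>
  have "sqrt (1 - \<epsilon>) * norm (?M *v a) \<le> ?i * (sqrt (1 - \<epsilon>) * norm_U R (B *v a))"
    using mult_left_mono[OF i[OF a(1)], of "sqrt (1 - \<epsilon>)"] assms(9) by (simp add: mult_ac)
  also have "\<dots> \<le> ?i * norm a"
    by (rule mult_left_mono[OF low i0])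
  finally have max: "max_gain ?M \<le> ?i / sqrt (1 - \<epsilon>)"
    unfolding a(2) using a(1) assms(9) by (simp add: field_simps)
  obtain c where c: "c \<noteq> 0" "min_gain ?M = norm (?M *v c) / norm c"
    using min_gain_attained[of ?M] by blast
  have "?z * norm c \<le> ?z * (sqrt (1 + \<epsilon>) * norm_U R (B *v c))"
    using up assms(10) by (intro mult_left_mono) auto
  also have "\<dots> \<le> sqrt (1 + \<epsilon>) * norm (?M *v c)"
    using mult_left_mono[OF z[OF c(1)], of "sqrt (1 + \<epsilon>)"] assms(8) by (simp add: mult_ac)
  finally have min: "?z / sqrt (1 + \<epsilon>) \<le> min_gain ?M"
    unfolding c(2) using c(1) assms(8) by (simp add: field_simps)
  \<comment> \<open>Positivity of \<open>?z\<close> makes the lower bound on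
    \<open>min_gain ?M\<close> positive, as monotonicity of the quotient demands.\<close>
  have "condition_number ?M \<le> (?i / sqrt (1 - \<epsilon>)) / (?z / sqrt (1 + \<epsilon>))"
    unfolding condition_number_def
    using max min i0 assms(8-10) by (intro frac_le) auto
  also have "\<dots> = sqrt ((1 + \<epsilon>) / (1 - \<epsilon>)) * (?i / ?z)"
    by (simp add: real_sqrt_divide)
  finally show ?thesis .
qed

end
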